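(* Let $R$ be a Noetherian commutative ring. Let $I,J$ be integrally closed ideals of $R$, each containing a non-zerodivisor on $R$, and suppose $I\subseteq J$. Set $B=J:J$. Then: (1) $I:J$ is an ideal of $B$ that contains a non-zerodivisor on $B$ and is integrally closed in $B$ (that is, $I:J\in\mathcal{X}_B$). (2) Suppose that there exists $b\in J$ such that $J^2=bJ$. Then $I:J=\frac{I}{b}$. Therefore $I=J\cdot(I:J)$, and $I:J\cong I$ as $B$-modules.
   Context: $\mathrm{Q}(R)$ is the total ring of fractions of $R$. For $R$-submodules $X,Y$ of $\mathrm{Q}(R)$, $X:Y=\{a\in\mathrm{Q}(R)\mid aY\subseteq X\}$; $J:J$ is a subring of $\mathrm{Q}(R)$ containing $R$. An ideal $\mathfrak a$ of a ring $A$ is integrally closed if it equals its integral closure $\overline{\mathfrak a}$ in $A$. For a ring $A$, $\mathcal{X}_A$ denotes the set of integrally closed ideals of $A$ containing a non-zerodivisor on $A$. $\frac{I}{b}=\{\frac{x}{b}\mid x\in I\}\subseteq\mathrm{Q}(R)$ (an element $b\in J$ with $J^2=bJ$ is a non-zerodivisor because $J$ contains one). Products of submodules of $\mathrm{Q}(R)$ are sets of finite sums of products. *)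

theory Defs
  imports "HOL-Algebra.Ring_Divisibility" "HOL-Algebra.Ideal_Product" "HOL-Algebra.Module"
begin

section \<open>The total ring of fractions\<close>

definition nonzerodivisors :: "('a, 'm) ring_scheme \<Rightarrow> 'a set" where
  "nonzerodivisors A =
     {s \<in> carrier A. \<forall>x \<in> carrier A. s \<otimes>\<^bsub>A\<^esub> x = \<zero>\<^bsub>A\<^esub> \<longrightarrow> x = \<zero>\<^bsub>A\<^esub>}"

text \<open>The fraction \<open>a / s\<close> is the class of \<open>(a, s)\<close> under \<open>(a, s) \<sim> (b, t) \<longleftrightarrow> a t = b s\<close>.
  Since all denominators are non-zerodivisors, this is already an equivalence relation.\<close>

definition fraction :: "('a, 'm) ring_scheme \<Rightarrow> 'a \<Rightarrow> 'a \<Rightarrow> ('a \<times> 'a) set" where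
  "fraction R a s =
     {(b, t). b \<in> carrier R \<and> t \<in> nonzerodivisors R \<and> a \<otimes>\<^bsub>R\<^esub> t = b \<otimes>\<^bsub>R\<^esub> s}"

text \<open>In the two operations all members of the union coincide
  (\<open>fraction_mult\<close>, \<open>fraction_add\<close> below).\<close>

definition total_fraction_ring :: "('a, 'm) ring_scheme \<Rightarrow> ('a \<times> 'a) set ring" where
  "total_fraction_ring R =
     \<lparr> carrier = {fraction R a s | a s. a \<in> carrier R \<and> s \<in> nonzerodivisors R},
       mult = (\<lambda>F G. \<Union>(a, s) \<in> F. \<Union>(b, t) \<in> G. fraction R (a \<otimes>\<^bsub>R\<^esub> b) (s \<otimes>\<^bsub>R\<^esub> t)),
       one = fraction R \<one>\<^bsub>R\<^esub> \<one>\<^bsub>R\<^esub>,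
       zero = fraction R \<zero>\<^bsub>R\<^esub> \<one>\<^bsub>R\<^esub>,
       add = (\<lambda>F G. \<Union>(a, s) \<in> F. \<Union>(b, t) \<in> G.
                fraction R (a \<otimes>\<^bsub>R\<^esub> t \<oplus>\<^bsub>R\<^esub> b \<otimes>\<^bsub>R\<^esub> s) (s \<otimes>\<^bsub>R\<^esub> t)) \<rparr>"

definition fraction_embed :: "('a, 'm) ring_scheme \<Rightarrow> 'a \<Rightarrow> ('a \<times> 'a) set" where
  "fraction_embed R a = fraction R a \<one>\<^bsub>R\<^esub>"

lemma UN_pairs_const:
  assumes "p \<in> F" "q \<in> G"
    and "\<And>a s b t. (a, s) \<in> F \<Longrightarrow> (b, t) \<in> G \<Longrightarrow> f a s b t = C"
  shows "(\<Union>(a, s) \<in> F. \<Union>(b, t) \<in> G. f a s b t) = C"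
proof -
  have inner: "(\<Union>(b, t) \<in> G. f a s b t) = C" if "(a, s) \<in> F" for a s
  proof -
    have "(\<Union>(b, t) \<in> G. f a s b t) = (\<Union>y \<in> G. C)"
      by (rule SUP_cong[OF refl]) (use that assms(3) in auto)
    then show ?thesis using assms(2) by auto
  qed
  have "(\<Union>(a, s) \<in> F. \<Union>(b, t) \<in> G. f a s b t) = (\<Union>x \<in> F. C)"
    by (rule SUP_cong[OF refl]) (use inner in \<open>simp only: split_paired_all prod.case\<close>)
  then show ?thesis using assms(1) by auto
qed

context cring
begin

lemma nonzerodivisors_carrier: "s \<in> nonzerodivisors R \<Longrightarrow> s \<in> carrier R"
  by (simp add: nonzerodivisors_def)

lemma one_nonzerodivisor: "\<one> \<in> nonzerodivisors R"
  by (simp add: nonzerodivisors_def)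

lemma mult_nonzerodivisor:
  assumes "s \<in> nonzerodivisors R" "t \<in> nonzerodivisors R"
  shows "s \<otimes> t \<in> nonzerodivisors R"
proof -
  have st: "s \<in> carrier R" "t \<in> carrier R"
    using assms by (simp_all add: nonzerodivisors_carrier)
  have "x = \<zero>" if x: "x \<in> carrier R" and eq: "s \<otimes> t \<otimes> x = \<zero>" for x
  proof -
    have "s \<otimes> (t \<otimes> x) = \<zero>" using eq x st by (simp add: m_assoc)
    then have "t \<otimes> x = \<zero>"
      using assms(1) m_closed[OF st(2) x] unfolding nonzerodivisors_def by blast
    then show ?thesis using assms(2) x unfolding nonzerodivisors_def by blast
  qed
  then show ?thesis using st unfolding nonzerodivisors_def by simp
qed

lemma nonzerodivisor_cancel:
  assumes s: "s \<in> nonzerodivisors R" and x: "x \<in> carrier R" "y \<in> carrier R"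
    and eq: "s \<otimes> x = s \<otimes> y"
  shows "x = y"
proof -
  have sc: "s \<in> carrier R" using s by (rule nonzerodivisors_carrier)
  have "s \<otimes> (x \<ominus> y) = s \<otimes> x \<ominus> s \<otimes> y" using sc x by algebra
  also have "\<dots> = \<zero>" using eq sc x by (simp add: r_right_minus_eq)
  finally have "x \<ominus> y = \<zero>"
    using s minus_closed[OF x] unfolding nonzerodivisors_def by blast
  then show ?thesis using x by simp
qed

lemma fraction_memD:
  assumes "(b, t) \<in> fraction R a s"
  shows "b \<in> carrier R" "t \<in> nonzerodivisors R" "t \<in> carrier R" "a \<otimes> t = b \<otimes> s"
  using assms by (auto simp: fraction_def nonzerodivisors_carrier)

lemma fraction_self:
  assumes "a \<in> carrier R" "s \<in> nonzerodivisors R"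
  shows "(a, s) \<in> fraction R a s"
  using assms by (simp add: fraction_def)

lemma fraction_eqI:
  assumes a: "a \<in> carrier R" and s: "s \<in> nonzerodivisors R"
    and b: "b \<in> carrier R" and t: "t \<in> nonzerodivisors R"
    and eq: "a \<otimes> t = b \<otimes> s"
  shows "fraction R a s = fraction R b t"
proof -
  have sub: "fraction R a s \<subseteq> fraction R b t"
    if a: "a \<in> carrier R" and s: "s \<in> nonzerodivisors R"
    and b: "b \<in> carrier R" and t: "t \<in> nonzerodivisors R"
    and eq: "a \<otimes> t = b \<otimes> s" for a s b t
  proof clarify
    fix c u assume cu: "(c, u) \<in> fraction R a s"
    note c = fraction_memD[OF cu]
    note cs = a b nonzerodivisors_carrier[OF s] nonzerodivisors_carrier[OF t] c(1,3)
    have "s \<otimes> (b \<otimes> u) = (b \<otimes> s) \<otimes> u" using cs by algebra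
    also have "\<dots> = (a \<otimes> u) \<otimes> t" unfolding eq[symmetric] using cs by algebra
    also have "\<dots> = s \<otimes> (c \<otimes> t)" unfolding c(4) using cs by algebra
    finally have "b \<otimes> u = c \<otimes> t"
      using s cs by (auto intro: nonzerodivisor_cancel)
    then show "(c, u) \<in> fraction R b t" using c by (simp add: fraction_def)
  qed
  show ?thesis using sub[OF assms] sub[OF b t a s eq[symmetric]] by blast
qed

lemma fraction_eq_iff:
  assumes "a \<in> carrier R" "s \<in> nonzerodivisors R" "b \<in> carrier R" "t \<in> nonzerodivisors R"
  shows "fraction R a s = fraction R b t \<longleftrightarrow> a \<otimes> t = b \<otimes> s"
  using fraction_eqI[OF assms] fraction_self[OF assms(3,4)] fraction_memD(4) by metis

lemma fraction_mult:
  assumes a: "a \<in> carrier R" and s: "s \<in> nonzerodivisors R"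
    and b: "b \<in> carrier R" and t: "t \<in> nonzerodivisors R"
  shows "fraction R a s \<otimes>\<^bsub>total_fraction_ring R\<^esub> fraction R b t = fraction R (a \<otimes> b) (s \<otimes> t)"
proof -
  have "fraction R (c \<otimes> d) (u \<otimes> v) = fraction R (a \<otimes> b) (s \<otimes> t)"
    if c: "(c, u) \<in> fraction R a s" and d: "(d, v) \<in> fraction R b t" for c d u v
  proof (rule fraction_eqI)
    note c = fraction_memD[OF c] and d = fraction_memD[OF d]
    note cs = a b nonzerodivisors_carrier[OF s] nonzerodivisors_carrier[OF t] c(1,3) d(1,3)
    show "c \<otimes> d \<otimes> (s \<otimes> t) = a \<otimes> b \<otimes> (u \<otimes> v)"
    proof -
      have "c \<otimes> d \<otimes> (s \<otimes> t) = (c \<otimes> s) \<otimes> (d \<otimes> t)" using cs by algebra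
      also have "\<dots> = a \<otimes> b \<otimes> (u \<otimes> v)"
        unfolding c(4)[symmetric] d(4)[symmetric] using cs by algebra
      finally show ?thesis .
    qed
    show "c \<otimes> d \<in> carrier R" "a \<otimes> b \<in> carrier R" using cs by simp_all
    show "u \<otimes> v \<in> nonzerodivisors R" "s \<otimes> t \<in> nonzerodivisors R"
      using c(2) d(2) s t by (simp_all add: mult_nonzerodivisor)
  qed
  then show ?thesis
    unfolding total_fraction_ring_def ring.simps monoid.simps
    by (rule UN_pairs_const[OF fraction_self[OF a s] fraction_self[OF b t]])
qed

lemma fraction_add:
  assumes a: "a \<in> carrier R" and s: "s \<in> nonzerodivisors R"
    and b: "b \<in> carrier R" and t: "t \<in> nonzerodivisors R"
  shows "fraction R a s \<oplus>\<^bsub>total_fraction_ring R\<^esub> fraction R b t = fraction R (a \<otimes> t \<oplus> b \<otimes> s) (s \<otimes> t)"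
proof -
  have "fraction R (c \<otimes> v \<oplus> d \<otimes> u) (u \<otimes> v) = fraction R (a \<otimes> t \<oplus> b \<otimes> s) (s \<otimes> t)"
    if c: "(c, u) \<in> fraction R a s" and d: "(d, v) \<in> fraction R b t" for c d u v
  proof (rule fraction_eqI)
    note c = fraction_memD[OF c] and d = fraction_memD[OF d]
    note cs = a b nonzerodivisors_carrier[OF s] nonzerodivisors_carrier[OF t] c(1,3) d(1,3)
    show "(c \<otimes> v \<oplus> d \<otimes> u) \<otimes> (s \<otimes> t) = (a \<otimes> t \<oplus> b \<otimes> s) \<otimes> (u \<otimes> v)"
    proof -
      have "(c \<otimes> v \<oplus> d \<otimes> u) \<otimes> (s \<otimes> t) = (c \<otimes> s) \<otimes> (v \<otimes> t) \<oplus> (d \<otimes> t) \<otimes> (u \<otimes> s)"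
        using cs by algebra
      also have "\<dots> = (a \<otimes> t \<oplus> b \<otimes> s) \<otimes> (u \<otimes> v)"
        unfolding c(4)[symmetric] d(4)[symmetric] using cs by algebra
      finally show ?thesis .
    qed
    show "c \<otimes> v \<oplus> d \<otimes> u \<in> carrier R" "a \<otimes> t \<oplus> b \<otimes> s \<in> carrier R" using cs by simp_all
    show "u \<otimes> v \<in> nonzerodivisors R" "s \<otimes> t \<in> nonzerodivisors R"
      using c(2) d(2) s t by (simp_all add: mult_nonzerodivisor)
  qed
  then show ?thesis
    unfolding total_fraction_ring_def ring.simps monoid.simps
    by (rule UN_pairs_const[OF fraction_self[OF a s] fraction_self[OF b t]])
qed

lemma total_fraction_ring_cring: "cring (total_fraction_ring R)"
proof -
  let ?Q = "total_fraction_ring R"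
  note [simp] = nonzerodivisors_carrier one_nonzerodivisor mult_nonzerodivisor fraction_mult fraction_add
  have carr: "X \<in> carrier ?Q \<longleftrightarrow> (\<exists>a s. X = fraction R a s \<and> a \<in> carrier R \<and> s \<in> nonzerodivisors R)" for X
    by (auto simp: total_fraction_ring_def)
  have one: "\<one>\<^bsub>?Q\<^esub> = fraction R \<one> \<one>" and zero: "\<zero>\<^bsub>?Q\<^esub> = fraction R \<zero> \<one>"
    by (simp_all add: total_fraction_ring_def)
  have fI: "fraction R a s \<in> carrier ?Q" if "a \<in> carrier R" "s \<in> nonzerodivisors R" for a s
    using that carr by blast
  have "abelian_group ?Q"
  proof (rule abelian_groupI)
    fix X Y assume "X \<in> carrier ?Q" "Y \<in> carrier ?Q"
    then show "X \<oplus>\<^bsub>?Q\<^esub> Y \<in> carrier ?Q" by (auto simp: carr[of X] carr[of Y] intro!: fI)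
  next
    show "\<zero>\<^bsub>?Q\<^esub> \<in> carrier ?Q" unfolding zero by (rule fI) auto
  next
    fix X Y Z assume "X \<in> carrier ?Q" "Y \<in> carrier ?Q" "Z \<in> carrier ?Q"
    then obtain a s b t c u where
      eqs: "X = fraction R a s" "Y = fraction R b t" "Z = fraction R c u"
      and cs: "a \<in> carrier R" "b \<in> carrier R" "c \<in> carrier R"
      and nz: "s \<in> nonzerodivisors R" "t \<in> nonzerodivisors R" "u \<in> nonzerodivisors R"
      unfolding carr by blast
    have nc: "s \<in> carrier R" "t \<in> carrier R" "u \<in> carrier R" using nz by simp_all
    have "((a \<otimes> t \<oplus> b \<otimes> s) \<otimes> u \<oplus> c \<otimes> (s \<otimes> t)) \<otimes> (s \<otimes> (t \<otimes> u)) =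
          (a \<otimes> (t \<otimes> u) \<oplus> (b \<otimes> u \<oplus> c \<otimes> t) \<otimes> s) \<otimes> (s \<otimes> t \<otimes> u)"
      using cs nc by algebra
    then show "X \<oplus>\<^bsub>?Q\<^esub> Y \<oplus>\<^bsub>?Q\<^esub> Z = X \<oplus>\<^bsub>?Q\<^esub> (Y \<oplus>\<^bsub>?Q\<^esub> Z)"
      using eqs cs nz by (simp add: fraction_eq_iff)
  next
    fix X Y assume "X \<in> carrier ?Q" "Y \<in> carrier ?Q"
    then obtain a s b t where
      eqs: "X = fraction R a s" "Y = fraction R b t"
      and cs: "a \<in> carrier R" "b \<in> carrier R"
      and nz: "s \<in> nonzerodivisors R" "t \<in> nonzerodivisors R"
      unfolding carr by blast
    have nc: "s \<in> carrier R" "t \<in> carrier R" using nz by simp_all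
    have "(a \<otimes> t \<oplus> b \<otimes> s) \<otimes> (t \<otimes> s) = (b \<otimes> s \<oplus> a \<otimes> t) \<otimes> (s \<otimes> t)"
      using cs nc by algebra
    then show "X \<oplus>\<^bsub>?Q\<^esub> Y = Y \<oplus>\<^bsub>?Q\<^esub> X"
      using eqs cs nz by (simp add: fraction_eq_iff)
  next
    fix X assume "X \<in> carrier ?Q"
    then obtain a s where X: "X = fraction R a s" "a \<in> carrier R" "s \<in> nonzerodivisors R"
      unfolding carr by blast
    then show "\<zero>\<^bsub>?Q\<^esub> \<oplus>\<^bsub>?Q\<^esub> X = X" by (simp add: zero)
    have s: "s \<in> carrier R" using X by simp
    have "(\<ominus> a \<otimes> s \<oplus> a \<otimes> s) \<otimes> \<one> = \<zero> \<otimes> (s \<otimes> s)"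
      using X(2) s by algebra
    then have "fraction R (\<ominus> a) s \<oplus>\<^bsub>?Q\<^esub> X = \<zero>\<^bsub>?Q\<^esub>"
      using X by (simp add: zero fraction_eq_iff)
    then show "\<exists>Y \<in> carrier ?Q. Y \<oplus>\<^bsub>?Q\<^esub> X = \<zero>\<^bsub>?Q\<^esub>" using X fI by (metis a_inv_closed)
  qed
  moreover have "comm_monoid ?Q"
  proof (rule comm_monoidI)
    fix X Y assume "X \<in> carrier ?Q" "Y \<in> carrier ?Q"
    then show "X \<otimes>\<^bsub>?Q\<^esub> Y \<in> carrier ?Q" by (auto simp: carr[of X] carr[of Y] intro!: fI)
  next
    show "\<one>\<^bsub>?Q\<^esub> \<in> carrier ?Q" unfolding one by (rule fI) auto
  next
    fix X Y Z assume "X \<in> carrier ?Q" "Y \<in> carrier ?Q" "Z \<in> carrier ?Q"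
    then show "X \<otimes>\<^bsub>?Q\<^esub> Y \<otimes>\<^bsub>?Q\<^esub> Z = X \<otimes>\<^bsub>?Q\<^esub> (Y \<otimes>\<^bsub>?Q\<^esub> Z)"
      by (auto simp: carr m_assoc)
  next
    fix X assume "X \<in> carrier ?Q"
    then show "\<one>\<^bsub>?Q\<^esub> \<otimes>\<^bsub>?Q\<^esub> X = X" by (auto simp: carr one)
  next
    fix X Y assume "X \<in> carrier ?Q" "Y \<in> carrier ?Q"
    then show "X \<otimes>\<^bsub>?Q\<^esub> Y = Y \<otimes>\<^bsub>?Q\<^esub> X" by (auto simp: carr m_comm)
  qed
  moreover have "(X \<oplus>\<^bsub>?Q\<^esub> Y) \<otimes>\<^bsub>?Q\<^esub> Z = X \<otimes>\<^bsub>?Q\<^esub> Z \<oplus>\<^bsub>?Q\<^esub> Y \<otimes>\<^bsub>?Q\<^esub> Z"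
    if XYZ: "X \<in> carrier ?Q" "Y \<in> carrier ?Q" "Z \<in> carrier ?Q" for X Y Z
  proof -
    obtain a s b t c u where
      eqs: "X = fraction R a s" "Y = fraction R b t" "Z = fraction R c u"
      and cs: "a \<in> carrier R" "b \<in> carrier R" "c \<in> carrier R"
      and nz: "s \<in> nonzerodivisors R" "t \<in> nonzerodivisors R" "u \<in> nonzerodivisors R"
      using XYZ unfolding carr by blast
    have nc: "s \<in> carrier R" "t \<in> carrier R" "u \<in> carrier R" using nz by simp_all
    have "((a \<otimes> t \<oplus> b \<otimes> s) \<otimes> c) \<otimes> ((s \<otimes> u) \<otimes> (t \<otimes> u)) =
          (a \<otimes> c \<otimes> (t \<otimes> u) \<oplus> b \<otimes> c \<otimes> (s \<otimes> u)) \<otimes> (s \<otimes> t \<otimes> u)"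
      using cs nc by algebra
    then show ?thesis
      using eqs cs nz by (simp add: fraction_eq_iff)
  qed
  ultimately show ?thesis by (rule cringI)
qed

lemma fraction_embed_hom: "fraction_embed R \<in> ring_hom R (total_fraction_ring R)"
proof -
  have "fraction_embed R a \<in> carrier (total_fraction_ring R)" if "a \<in> carrier R" for a
    unfolding total_fraction_ring_def fraction_embed_def using that one_nonzerodivisor by simp blast
  moreover have "fraction_embed R \<one> = \<one>\<^bsub>total_fraction_ring R\<^esub>"
    by (simp add: fraction_embed_def total_fraction_ring_def)
  ultimately show ?thesis
    by (intro ring_hom_memI)
      (simp_all add: fraction_embed_def fraction_mult fraction_add one_nonzerodivisor)
qed

lemma fraction_embed_inj: "inj_on (fraction_embed R) (carrier R)"
  by (auto simp: inj_on_def fraction_embed_def fraction_eq_iff one_nonzerodivisor)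

lemma fraction_mult_denominator:
  assumes "a \<in> carrier R" "s \<in> nonzerodivisors R"
  shows "fraction R a s \<otimes>\<^bsub>total_fraction_ring R\<^esub> fraction_embed R s = fraction_embed R a"
  using assms
  by (simp add: fraction_embed_def fraction_mult fraction_eq_iff one_nonzerodivisor
      nonzerodivisors_carrier)

end


section \<open>Integrally closed ideals\<close>

text \<open>An element \<open>x\<close> of \<open>A\<close> is integral over the ideal \<open>I\<close> if
  \<open>x^n + a_1 x^(n-1) + \<dots> + a_n = 0\<close> for some \<open>n \<ge> 1\<close> and \<open>a_i \<in> I^i\<close>; the power \<open>I^i\<close> is taken
  in the monoid of ideals of \<open>A\<close>.\<close>

definition ideal_integral_closure :: "('a, 'm) ring_scheme \<Rightarrow> 'a set \<Rightarrow> 'a set" where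
  "ideal_integral_closure A I =
     {x \<in> carrier A. \<exists>n a. (1::nat) \<le> n \<and>
        (\<forall>i \<in> {1..n}. a i \<in> I [^]\<^bsub>ideals_set A\<^esub> i) \<and>
        x [^]\<^bsub>A\<^esub> n \<oplus>\<^bsub>A\<^esub> (\<Oplus>\<^bsub>A\<^esub>i \<in> {1..n}. a i \<otimes>\<^bsub>A\<^esub> x [^]\<^bsub>A\<^esub> (n - i)) = \<zero>\<^bsub>A\<^esub>}"

definition integrally_closed_ideal :: "'a set \<Rightarrow> ('a, 'm) ring_scheme \<Rightarrow> bool" where
  "integrally_closed_ideal I A \<longleftrightarrow> ideal I A \<and> ideal_integral_closure A I = I"

definition regular_integrally_closed_ideals :: "('a, 'm) ring_scheme \<Rightarrow> 'a set set"
    (\<open>\<X>\<index>\<close>) where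
  "\<X>\<^bsub>A\<^esub> = {I. integrally_closed_ideal I A \<and> I \<inter> nonzerodivisors A \<noteq> {}}"


section \<open>Colons and submodules of an overring\<close>

definition colon :: "('a, 'm) ring_scheme \<Rightarrow> 'a set \<Rightarrow> 'a set \<Rightarrow> 'a set" where
  "colon Q X Y = {a \<in> carrier Q. \<forall>y \<in> Y. a \<otimes>\<^bsub>Q\<^esub> y \<in> X}"

text \<open>The additive subgroup \<open>M\<close> of \<open>Q\<close>, with scalars acting by multiplication in \<open>Q\<close>. The record
  type for modules also has the fields \<open>mult\<close> and \<open>one\<close>, which are irrelevant here.\<close>

definition submodule_of_ring :: "('a, 'm) ring_scheme \<Rightarrow> 'a set \<Rightarrow> ('a, 'a) module" where
  "submodule_of_ring Q M =
     \<lparr> carrier = M, mult = mult Q, one = one Q, zero = zero Q, add = add Q, smult = mult Q \<rparr>"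

definition module_isomorphic ::
    "('r, 'm) ring_scheme \<Rightarrow> ('r, 'a, 'k) module_scheme \<Rightarrow> ('r, 'b, 'l) module_scheme \<Rightarrow> bool" where
  "module_isomorphic B M N \<longleftrightarrow> module B M \<and> module B N \<and>
     (\<exists>f \<in> iso (add_monoid M) (add_monoid N).
        \<forall>r \<in> carrier B. \<forall>x \<in> carrier M. f (r \<odot>\<^bsub>M\<^esub> x) = r \<odot>\<^bsub>N\<^esub> f x)"

end

theory Submission
  imports Defs "HOL-Algebra.Subrings"
begin

text \<open>
  If \<open>x\<close> is integral over \<open>I : J\<close> in \<open>B\<close>, multiplying an integral equation of degree \<open>n\<close> by
  \<open>y^n\<close>, \<open>y \<in> J\<close>, gives an integral equation of \<open>x y \<in> R\<close> over \<open>I\<close>, because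
  \<open>(I : J)^i y^i \<subseteq> I^i\<close>; so \<open>x y \<in> I\<close>.

  For a non-zerodivisor \<open>s \<in> J\<close> and \<open>c \<in> B\<close>, the elements \<open>c^k s\<close> all lie in \<open>J \<subseteq> R\<close>, so the
  ascending chain condition and cancellation of \<open>s\<close> show that \<open>c\<close> is integral over \<open>R\<close>. Scaling its
  equation by \<open>x^n\<close>, \<open>x \<in> I\<close>, shows that \<open>c x \<in> J\<close> is integral over \<open>I\<close>; hence \<open>B I \<subseteq> I\<close>. If
  \<open>J^2 = b J\<close>, then \<open>y / b \<in> B\<close> for \<open>y \<in> J\<close>, so \<open>(x / b) y = (y / b) x \<in> I\<close> for \<open>x \<in> I\<close>, which is
  \<open>I / b \<subseteq> I : J\<close>.
\<close>

section \<open>Powers of ideals and integral equations\<close>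

lemma ideals_set_one [simp]: "\<one>\<^bsub>ideals_set A\<^esub> = carrier A"
  by (simp add: ideals_set_def)

lemma ideals_set_mult [simp]: "I \<otimes>\<^bsub>ideals_set A\<^esub> J = ideal_prod A I J"
  by (simp add: ideals_set_def)

text \<open>Powers in \<open>ideals_set\<close> start from the unit ideal, so the first power of
  \<open>I\<close> unfolds to \<open>carrier R\<close> times \<open>I\<close>; this rule collapses
  it to \<open>I\<close>.\<close>

lemma (in cring) carrier_ideal_prod:
  assumes "ideal I R"
  shows "ideal_prod R (carrier R) I = I"
  using ideal_prod_one[OF assms] ideal_prod_commute[OF assms oneideal] by simp

lemma (in ring) ideals_set_pow_ideal:
  assumes "ideal I R"
  shows "ideal (I [^]\<^bsub>ideals_set R\<^esub> (n::nat)) R"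
  by (induction n) (simp_all add: oneideal ideal_prod_is_ideal assms)

lemma (in ring) pow_mem_ideals_set_pow:
  assumes "ideal I R" "x \<in> I"
  shows "x [^] n \<in> I [^]\<^bsub>ideals_set R\<^esub> (n::nat)"
  by (induction n) (auto simp: assms(2) intro: ideal_prod.prod)

text \<open>Degree one suffices: \<open>x\<close> solves the equation with \<open>n = 1\<close> and
  \<open>a 1 = \<ominus> x\<close>.\<close>

lemma (in cring) ideal_subset_integral_closure:
  assumes "ideal I R"
  shows "I \<subseteq> ideal_integral_closure R I"
proof
  fix x assume x: "x \<in> I"
  interpret I: ideal I R by fact
  have xc: "x \<in> carrier R" using x by (rule I.Icarr)
  have "(\<Oplus>i \<in> {1..1::nat}. (\<ominus> x) \<otimes> x [^] (1 - i)) = \<ominus> x"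
    using xc by simp
  then have "x [^] (1::nat) \<oplus> (\<Oplus>i \<in> {1..1::nat}. (\<ominus> x) \<otimes> x [^] (1 - i)) = \<zero>"
    using xc by (simp add: r_neg)
  moreover have "\<forall>i \<in> {1..1::nat}. \<ominus> x \<in> I [^]\<^bsub>ideals_set R\<^esub> i"
    using x by (simp add: carrier_ideal_prod[OF assms])
  ultimately show "x \<in> ideal_integral_closure R I"
    unfolding ideal_integral_closure_def using xc
    by (intro CollectI conjI exI[of _ "1::nat"] exI[of _ "\<lambda>i. \<ominus> x"]) auto
qed

text \<open>Multiply the equation by \<open>y [^] n\<close>. In the \<open>i\<close>-th term,
  \<open>y [^] (n - i)\<close> is absorbed into the power of \<open>x\<close> and the remaining
  \<open>y [^] i\<close> into the coefficient.\<close>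

lemma (in cring) integral_equation_scale:
  assumes x: "x \<in> carrier R" and y: "y \<in> carrier R"
    and a: "\<And>i. i \<in> {1..n} \<Longrightarrow> a i \<in> carrier R"
    and eq: "x [^] n \<oplus> (\<Oplus>i \<in> {1..n::nat}. a i \<otimes> x [^] (n - i)) = \<zero>"
  shows "(x \<otimes> y) [^] n \<oplus> (\<Oplus>i \<in> {1..n}. (a i \<otimes> y [^] i) \<otimes> (x \<otimes> y) [^] (n - i)) = \<zero>"
proof -
  have "(a i \<otimes> y [^] i) \<otimes> (x \<otimes> y) [^] (n - i) = a i \<otimes> x [^] (n - i) \<otimes> y [^] n"
    if i: "i \<in> {1..n}" for i
  proof -
    have "y [^] n = y [^] i \<otimes> y [^] (n - i)"
      using i y by (simp add: nat_pow_mult)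
    then show ?thesis
      using x y a[OF i] by (simp add: nat_pow_distrib m_ac)
  qed
  then have "(\<Oplus>i \<in> {1..n}. (a i \<otimes> y [^] i) \<otimes> (x \<otimes> y) [^] (n - i)) =
      (\<Oplus>i \<in> {1..n}. a i \<otimes> x [^] (n - i) \<otimes> y [^] n)"
    using x y a by (intro finsum_cong') auto
  also have "\<dots> = (\<Oplus>i \<in> {1..n}. a i \<otimes> x [^] (n - i)) \<otimes> y [^] n"
    using x y a by (intro finsum_ldistr[symmetric]) auto
  finally have "(x \<otimes> y) [^] n \<oplus> (\<Oplus>i \<in> {1..n}. (a i \<otimes> y [^] i) \<otimes> (x \<otimes> y) [^] (n - i)) =
      (x [^] n \<oplus> (\<Oplus>i \<in> {1..n}. a i \<otimes> x [^] (n - i))) \<otimes> y [^] n"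
    using x y a by (subst l_distr) (auto simp: nat_pow_distrib intro!: finsum_closed)
  then show ?thesis using eq y by simp
qed


section \<open>Sequences in Noetherian rings\<close>

lemma (in noetherian_ring) sequence_linear_dependence:
  fixes t :: "nat \<Rightarrow> 'a"
  assumes "cring R" and t: "\<And>k. t k \<in> carrier R"
  obtains n r where "1 \<le> n" "\<And>i. r i \<in> carrier R" "t n = (\<Oplus>i \<in> {..<n}. r i \<otimes> t i)"
proof -
  interpret cring R by fact
  \<comment> \<open>\<open>C n\<close> is the ideal generated by \<open>t 0, ..., t (n - 1)\<close>,
    built one principal ideal at a time so that its properties follow by induction.\<close>
  define C where "C = rec_nat {\<zero>} (\<lambda>n D. D <+>\<^bsub>R\<^esub> PIdl (t n))"
  have C_Suc: "C (Suc n) = C n <+>\<^bsub>R\<^esub> PIdl (t n)" for n by (simp add: C_def)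
  have C_ideal: "ideal (C n) R" for n
    by (induction n)
      (simp add: C_def zeroideal, simp add: C_Suc add_ideals cgenideal_ideal t)
  have comb: "\<exists>r. (\<forall>i. r i \<in> carrier R) \<and> x = (\<Oplus>i \<in> {..<n}. r i \<otimes> t i)" if "x \<in> C n" for x n
    using that
  proof (induction n arbitrary: x)
    case 0
    then show ?case by (auto simp: C_def)
  next
    case (Suc n)
    then obtain y a where y: "y \<in> C n" and a: "a \<in> carrier R" and x: "x = y \<oplus> a \<otimes> t n"
      by (auto simp: C_Suc set_add_def' cgenideal_def)
    obtain r where r: "\<And>i. r i \<in> carrier R" "y = (\<Oplus>i \<in> {..<n}. r i \<otimes> t i)"
      using Suc.IH[OF y] by blast
    have "(\<Oplus>i \<in> {..<n}. (r(n := a)) i \<otimes> t i) = y"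
      unfolding r(2) using r(1) t by (intro finsum_cong') auto
    then have "(\<Oplus>i \<in> {..<Suc n}. (r(n := a)) i \<otimes> t i) = x"
      using r a t unfolding lessThan_Suc x
      by (subst finsum_insert) (auto simp: a_comm)
    then show ?case using r(1) a by (intro exI[of _ "r(n := a)"]) auto
  qed
  have step: "C n \<subseteq> C (Suc n)" and mem: "t n \<in> C (Suc n)" for n
  proof -
    interpret P: ideal "PIdl (t n)" R by (rule cgenideal_ideal[OF t])
    interpret Cn: ideal "C n" R by (rule C_ideal)
    have "x \<oplus> \<zero> \<in> C (Suc n)" if "x \<in> C n" for x
      unfolding C_Suc set_add_def' using that P.zero_closed by blast
    then show "C n \<subseteq> C (Suc n)" using Cn.Icarr by fastforce
    have "\<zero> \<oplus> t n \<in> C (Suc n)"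
      unfolding C_Suc set_add_def' using cgenideal_self[OF t] Cn.zero_closed by blast
    then show "t n \<in> C (Suc n)" using t by simp
  qed
  have mono: "C m \<subseteq> C n" if "m \<le> n" for m n
    using lift_Suc_mono_le[of C, OF step that] .
  have "subset.chain {I. ideal I R} (range C)"
    using C_ideal mono unfolding pred_on.chain_def
    by (auto simp: subset_eq psubset_eq) (metis nat_le_linear subsetD)+
  \<comment> \<open>The ascending chain condition enters here: in a Noetherian ring a nonempty chain
    of ideals contains its union.\<close>
  then have "\<Union>(range C) \<in> range C"
    by (intro ideal_chain_is_trivial) auto
  then obtain m where "\<Union>(range C) = C m" by blast
  \<comment> \<open>The chain is constant from \<open>m\<close> on. Taking \<open>Suc m\<close>
    instead of \<open>m\<close> ensures \<open>1 \<le> n\<close> in the conclusion.\<close>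
  then have "t (Suc m) \<in> C (Suc m)" using mem step[of m] by blast
  then obtain r where "\<And>i. r i \<in> carrier R" "t (Suc m) = (\<Oplus>i \<in> {..<Suc m}. r i \<otimes> t i)"
    using comb by blast
  then show ?thesis by (intro that[of "Suc m" r]) auto
qed


section \<open>Colons and subrings\<close>

lemma colon_carrier: "a \<in> colon A X Y \<Longrightarrow> a \<in> carrier A"
  by (simp add: colon_def)

lemma colonD: "a \<in> colon A X Y \<Longrightarrow> y \<in> Y \<Longrightarrow> a \<otimes>\<^bsub>A\<^esub> y \<in> X"
  by (simp add: colon_def)

lemma (in cring) colon_subgroup:
  assumes X: "subgroup X (add_monoid R)" and Y: "Y \<subseteq> carrier R"
  shows "subgroup (colon R X Y) (add_monoid R)"
proof -
  interpret X: additive_subgroup X R using X by (rule additive_subgroup.intro)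
  show ?thesis
  proof (rule add.subgroupI)
    show "colon R X Y \<subseteq> carrier R" by (auto simp: colon_def)
    have "\<zero> \<in> colon R X Y" using Y by (auto simp: colon_def)
    then show "colon R X Y \<noteq> {}" by blast
  next
    fix a assume a: "a \<in> colon R X Y"
    have "\<ominus> a \<otimes> y \<in> X" if "y \<in> Y" for y
      using colonD[OF a that] colon_carrier[OF a] that Y by (simp add: l_minus subset_eq)
    then show "\<ominus> a \<in> colon R X Y" using colon_carrier[OF a] by (simp add: colon_def)
  next
    fix a b assume ab: "a \<in> colon R X Y" "b \<in> colon R X Y"
    have "(a \<oplus> b) \<otimes> y \<in> X" if "y \<in> Y" for y
      using ab[THEN colonD, OF that] ab[THEN colon_carrier] that Y
      by (simp add: l_distr subset_eq)
    then show "a \<oplus> b \<in> colon R X Y" using ab[THEN colon_carrier] by (simp add: colon_def)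
  qed
qed

text \<open>Associativity gives this. With \<open>X = Y = Z\<close> it closes X : X under products;
  with \<open>Y = Z\<close> it lets X : Y absorb Y : Y.\<close>

lemma (in cring) colon_mult:
  assumes "a \<in> colon R X Y" "b \<in> colon R Y Z" "Z \<subseteq> carrier R"
  shows "a \<otimes> b \<in> colon R X Z"
proof -
  have "a \<otimes> b \<otimes> z \<in> X" if "z \<in> Z" for z
    using assms that by (auto simp: colon_def m_assoc subset_eq)
  then show ?thesis using assms by (auto simp: colon_def)
qed

lemma (in cring) colon_self_subcring:
  assumes X: "subgroup X (add_monoid R)"
  shows "subcring (colon R X X) R"
proof (rule subcringI'[OF subringI])
  have Xc: "X \<subseteq> carrier R" using subgroup.subset[OF X] by simp
  note sub = colon_subgroup[OF X Xc]
  show "colon R X X \<subseteq> carrier R" by (auto simp: colon_def)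
  show "\<one> \<in> colon R X X" using Xc by (auto simp: colon_def)
  show "\<ominus> a \<in> colon R X X" if "a \<in> colon R X X" for a
    using subgroup.m_inv_closed[OF sub that] by (simp add: a_inv_def)
  show "a \<otimes> b \<in> colon R X X" if "a \<in> colon R X X" "b \<in> colon R X X" for a b
    using that Xc by (rule colon_mult)
  show "a \<oplus> b \<in> colon R X X" if "a \<in> colon R X X" "b \<in> colon R X X" for a b
    using subgroup.m_closed[OF sub that] by simp
qed

text \<open>The inclusion \<open>X \<subseteq> Y\<close> places X : Y inside Y : Y, and absorption
  is \<open>colon_mult\<close> with \<open>Z = Y\<close>.\<close>

lemma (in cring) colon_ideal:
  assumes X: "subgroup X (add_monoid R)" and Y: "subgroup Y (add_monoid R)" and XY: "X \<subseteq> Y"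
  shows "ideal (colon R X Y) (R\<lparr>carrier := colon R Y Y\<rparr>)"
proof (rule idealI)
  let ?B = "R\<lparr>carrier := colon R Y Y\<rparr>"
  have Yc: "Y \<subseteq> carrier R" using subgroup.subset[OF Y] by simp
  have B: "subcring (colon R Y Y) R" using Y by (rule colon_self_subcring)
  then show "ring ?B"
    using subcring_iff[OF subcringE(1)[OF B]] cring.axioms(1) by blast
  have sub: "colon R X Y \<subseteq> colon R Y Y" using XY by (auto simp: colon_def)
  have "subgroup (colon R X Y) ((add_monoid R)\<lparr>carrier := colon R Y Y\<rparr>)"
    using add.subgroup_incl colon_subgroup[OF X Yc] colon_subgroup[OF Y Yc] sub by blast
  then show "subgroup (colon R X Y) (add_monoid ?B)" by simp
  fix a x assume a: "a \<in> colon R X Y" and x: "x \<in> carrier ?B"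
  have "a \<otimes> x \<in> colon R X Y" using a x Yc by (auto intro: colon_mult)
  moreover have "x \<otimes> a = a \<otimes> x" using a x by (auto simp: colon_def m_comm)
  ultimately show "x \<otimes>\<^bsub>?B\<^esub> a \<in> colon R X Y" "a \<otimes>\<^bsub>?B\<^esub> x \<in> colon R X Y" by simp_all
qed

text \<open>Since \<open>finsum\<close> depends on the carrier, this is not mere unfolding: the
  inclusion of \<open>T\<close> is a homomorphism, and homomorphisms commute with finite
  sums.\<close>

lemma (in cring) subcring_finsum:
  assumes T: "subcring T R" and f: "f \<in> A \<rightarrow> T"
  shows "finsum (R\<lparr>carrier := T\<rparr>) f A = finsum R f A"
proof -
  interpret T: cring "R\<lparr>carrier := T\<rparr>" using T subcring_iff[OF subcringE(1)[OF T]] by simp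
  interpret ring_hom_cring "R\<lparr>carrier := T\<rparr>" R id
    by unfold_locales (use subcringE(1)[OF T] in \<open>auto intro!: ring_hom_memI\<close>)
  show ?thesis using hom_finsum[of f A] f by simp
qed

section \<open>Additive subgroups as modules over a subring\<close>

lemma (in cring) submodule_of_ring_module:
  assumes T: "subcring T R" and M: "subgroup M (add_monoid R)"
    and TM: "\<And>a x. a \<in> T \<Longrightarrow> x \<in> M \<Longrightarrow> a \<otimes> x \<in> M"
  shows "module (R\<lparr>carrier := T\<rparr>) (submodule_of_ring R M)"
proof (rule moduleI)
  have Mc: "x \<in> carrier R" if "x \<in> M" for x using subgroup.subset[OF M] that by auto
  show "cring (R\<lparr>carrier := T\<rparr>)" using T subcring_iff[OF subcringE(1)[OF T]] by simp
  show "abelian_group (submodule_of_ring R M)"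
  proof (rule abelian_groupI)
    interpret M: additive_subgroup M R using M by (rule additive_subgroup.intro)
    fix x assume "x \<in> carrier (submodule_of_ring R M)"
    then have "\<ominus> x \<in> M" "\<ominus> x \<oplus> x = \<zero>"
      by (auto simp: submodule_of_ring_def l_neg)
    then show "\<exists>y \<in> carrier (submodule_of_ring R M).
        y \<oplus>\<^bsub>submodule_of_ring R M\<^esub> x = \<zero>\<^bsub>submodule_of_ring R M\<^esub>"
      by (auto simp: submodule_of_ring_def)
  qed (use Mc subgroup.m_closed[OF M] subgroup.one_closed[OF M] in
      \<open>auto simp: submodule_of_ring_def a_ac\<close>)
qed (use TM subcringE(1)[OF T] subgroup.subset[OF M] in
    \<open>auto simp: submodule_of_ring_def subset_eq l_distr r_distr m_assoc\<close>)

text \<open>Multiplication by \<open>b\<close> is the isomorphism: it is injective because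
  \<open>b\<close> is a non-zerodivisor, onto by \<open>NM\<close>, and linear by commutativity. The
  same commutation carries stability under \<open>T\<close> from \<open>M\<close> to
  \<open>N\<close>.\<close>

lemma (in cring) submodule_of_ring_isomorphic:
  assumes T: "subcring T R" and M: "subgroup M (add_monoid R)"
    and TM: "\<And>a x. a \<in> T \<Longrightarrow> x \<in> M \<Longrightarrow> a \<otimes> x \<in> M"
    and N: "subgroup N (add_monoid R)" and NM: "N = (\<lambda>x. b \<otimes> x) ` M"
    and b: "b \<in> nonzerodivisors R"
  shows "module_isomorphic (R\<lparr>carrier := T\<rparr>) (submodule_of_ring R M) (submodule_of_ring R N)"
proof -
  have Tc: "a \<in> carrier R" if "a \<in> T" for a using subcringE(1)[OF T] that by blast
  have Mc: "x \<in> carrier R" if "x \<in> M" for x using subgroup.subset[OF M] that by auto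
  have bc: "b \<in> carrier R" using b by (rule nonzerodivisors_carrier)
  have comm: "b \<otimes> (a \<otimes> x) = a \<otimes> (b \<otimes> x)" if "a \<in> T" "x \<in> M" for a x
    using bc Tc[OF that(1)] Mc[OF that(2)] by (simp add: m_lcomm)
  have TN: "a \<otimes> x \<in> N" if a: "a \<in> T" and x: "x \<in> N" for a x
  proof -
    obtain y where "y \<in> M" "x = b \<otimes> y" using x NM by blast
    then show ?thesis using TM[OF a] comm[OF a] unfolding NM by (metis imageI)
  qed
  have "inj_on (\<lambda>x. b \<otimes> x) M"
    using nonzerodivisor_cancel[OF b] Mc by (auto intro!: inj_onI)
  then have "(\<lambda>x. b \<otimes> x) \<in>
      iso (add_monoid (submodule_of_ring R M)) (add_monoid (submodule_of_ring R N))"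
    using bc Mc NM
    by (auto simp: iso_def hom_def bij_betw_def submodule_of_ring_def r_distr)
  then show ?thesis
    unfolding module_isomorphic_def
    using submodule_of_ring_module[OF T M TM] submodule_of_ring_module[OF T N TN] comm
    by (auto simp: submodule_of_ring_def)
qed


section \<open>Ideals seen in an overring\<close>

text \<open>The intended instance is the embedding of a ring into its total ring of fractions.
  Elements of the two rings may have different types, so ideals of \<open>R\<close> appear in
  \<open>S\<close> as images under \<open>h\<close>.\<close>

locale ring_extension = ring_hom_cring +
  assumes inj: "inj_on h (carrier R)"
begin

text \<open>Scaling the equation of \<open>c\<close> by \<open>h x\<close> gives one for
  \<open>h u\<close> whose coefficients come from the powers of \<open>I\<close>; injectivity of
  \<open>h\<close> pulls it back to \<open>R\<close>. The form of \<open>ax\<close> covers two uses: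
  coefficients in powers of I : J with \<open>x \<in> J\<close>, and coefficients from
  \<open>R\<close> with \<open>x \<in> I\<close>.\<close>

lemma integral_equation_imp_mem:
  assumes I: "integrally_closed_ideal I R"
    and c: "c \<in> carrier S" and x: "x \<in> carrier R" and u: "u \<in> carrier R"
    and cx: "c \<otimes>\<^bsub>S\<^esub> h x = h u"
    and n: "1 \<le> n" and a: "\<And>i. i \<in> {1..n} \<Longrightarrow> a i \<in> carrier S"
    and ax: "\<And>i. i \<in> {1..n} \<Longrightarrow> a i \<otimes>\<^bsub>S\<^esub> h x [^]\<^bsub>S\<^esub> i \<in> h ` (I [^]\<^bsub>ideals_set R\<^esub> i)"
    and eq: "c [^]\<^bsub>S\<^esub> n \<oplus>\<^bsub>S\<^esub> (\<Oplus>\<^bsub>S\<^esub>i \<in> {1..n::nat}. a i \<otimes>\<^bsub>S\<^esub> c [^]\<^bsub>S\<^esub> (n - i)) = \<zero>\<^bsub>S\<^esub>"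
  shows "u \<in> I"
proof -
  have idl: "ideal I R" using I by (simp add: integrally_closed_ideal_def)
  have "\<exists>d. \<forall>i \<in> {1..n}. d i \<in> I [^]\<^bsub>ideals_set R\<^esub> i \<and> a i \<otimes>\<^bsub>S\<^esub> h x [^]\<^bsub>S\<^esub> i = h (d i)"
    using ax by (intro bchoice) blast
  then obtain d where d: "\<And>i. i \<in> {1..n} \<Longrightarrow> d i \<in> I [^]\<^bsub>ideals_set R\<^esub> i"
    and hd: "\<And>i. i \<in> {1..n} \<Longrightarrow> a i \<otimes>\<^bsub>S\<^esub> h x [^]\<^bsub>S\<^esub> i = h (d i)"
    by blast
  have dc: "d i \<in> carrier R" if "i \<in> {1..n}" for i
    using ideal.Icarr[OF R.ideals_set_pow_ideal[OF idl] d[OF that]] .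
  let ?e = "u [^] n \<oplus> (\<Oplus>i \<in> {1..n}. d i \<otimes> u [^] (n - i))"
  have "h (\<Oplus>i \<in> {1..n}. d i \<otimes> u [^] (n - i)) =
      (\<Oplus>\<^bsub>S\<^esub>i \<in> {1..n}. (h \<circ> (\<lambda>i. d i \<otimes> u [^] (n - i))) i)"
    using dc u by (intro hom_finsum) auto
  also have "\<dots> = (\<Oplus>\<^bsub>S\<^esub>i \<in> {1..n}. (a i \<otimes>\<^bsub>S\<^esub> h x [^]\<^bsub>S\<^esub> i) \<otimes>\<^bsub>S\<^esub> (c \<otimes>\<^bsub>S\<^esub> h x) [^]\<^bsub>S\<^esub> (n - i))"
    using dc u a c x by (intro S.finsum_cong') (auto simp: hd cx)
  finally have "h ?e = (c \<otimes>\<^bsub>S\<^esub> h x) [^]\<^bsub>S\<^esub> n \<oplus>\<^bsub>S\<^esub>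
      (\<Oplus>\<^bsub>S\<^esub>i \<in> {1..n}. (a i \<otimes>\<^bsub>S\<^esub> h x [^]\<^bsub>S\<^esub> i) \<otimes>\<^bsub>S\<^esub> (c \<otimes>\<^bsub>S\<^esub> h x) [^]\<^bsub>S\<^esub> (n - i))"
    using dc u by (subst hom_add) (auto simp: cx intro!: R.finsum_closed)
  also have "\<dots> = \<zero>\<^bsub>S\<^esub>"
    using c x a eq by (intro S.integral_equation_scale) auto
  finally have "h ?e = h \<zero>" by simp
  moreover have "?e \<in> carrier R" using dc u by (auto intro!: R.finsum_closed)
  ultimately have "?e = \<zero>" using inj by (meson inj_onD R.zero_closed)
  then have "u \<in> ideal_integral_closure R I"
    unfolding ideal_integral_closure_def using u n d by blast
  then show ?thesis using I by (simp add: integrally_closed_ideal_def)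
qed

section \<open>Integral closedness of the colon ideal\<close>

lemma image_subgroup:
  assumes "ideal I R"
  shows "subgroup (h ` I) (add_monoid S)"
proof -
  interpret g: group_hom "add_monoid R" "add_monoid S" h by (rule ring.a_group_hom)
  interpret ideal I R by fact
  show ?thesis by (rule g.subgroup_img_is_subgroup[OF a_subgroup])
qed

text \<open>Each factor from the colon is paired with one factor \<open>h y\<close>, which moves it
  into the image of \<open>I\<close>. The exponent is a successor because at exponent 0 the claim
  would put all of \<open>B\<close> into the image of \<open>R\<close>.\<close>

lemma colon_pow_mult_mem:
  fixes I J T defines "K \<equiv> colon S (h ` I) (h ` J)" and "B \<equiv> S\<lparr>carrier := T\<rparr>"
  assumes B: "cring B" and K: "ideal K B" and I: "ideal I R" and J: "J \<subseteq> carrier R"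
    and y: "y \<in> J" and a: "a \<in> K [^]\<^bsub>ideals_set B\<^esub> Suc k"
  shows "a \<in> carrier S \<and> a \<otimes>\<^bsub>S\<^esub> h y [^]\<^bsub>S\<^esub> Suc k \<in> h ` (I [^]\<^bsub>ideals_set R\<^esub> Suc k)"
  using a
proof (induction k arbitrary: a)
  case 0
  then have "a \<in> K" by (simp add: cring.carrier_ideal_prod[OF B K])
  then show ?case
    using y J by (auto simp: K_def R.carrier_ideal_prod[OF I] colon_def)
next
  case (Suc k)
  define P where "P = I [^]\<^bsub>ideals_set R\<^esub> Suc k"
  define L where "L = K [^]\<^bsub>ideals_set B\<^esub> Suc k"
  define w where "w = h y [^]\<^bsub>S\<^esub> Suc k"
  have hy: "h y \<in> carrier S" using y J by blast
  have w: "w \<in> carrier S" using hy by (simp add: w_def)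
  have IH: "a \<in> carrier S" "a \<otimes>\<^bsub>S\<^esub> w \<in> h ` P" if "a \<in> L" for a
    using Suc.IH[of a] that by (simp_all only: P_def L_def w_def)
  have P: "ideal P R" unfolding P_def using I by (rule R.ideals_set_pow_ideal)
  have PI: "ideal (ideal_prod R P I) R" using P I by (rule R.ideal_prod_is_ideal)
  have "a \<in> ideal_prod B L K" using Suc.prems by (simp add: L_def)
  then have "a \<in> carrier S \<and> a \<otimes>\<^bsub>S\<^esub> (w \<otimes>\<^bsub>S\<^esub> h y) \<in> h ` ideal_prod R P I"
  proof (induction a rule: ideal_prod.induct)
    case (prod i j)
    obtain p where p: "p \<in> P" "i \<otimes>\<^bsub>S\<^esub> w = h p" using IH(2)[OF prod(1)] by blast
    have jc: "j \<in> carrier S" using prod(2) by (simp add: K_def colon_def)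
    obtain q where q: "q \<in> I" "j \<otimes>\<^bsub>S\<^esub> h y = h q"
      using prod(2) y by (auto simp: K_def colon_def)
    \<comment> \<open>Regrouping leaves \<open>w\<close> with \<open>i\<close>, where the outer
      induction hypothesis applies, and \<open>h y\<close> with \<open>j\<close>, where the
      definition of the colon applies.\<close>
    have "i \<otimes>\<^bsub>S\<^esub> j \<otimes>\<^bsub>S\<^esub> (w \<otimes>\<^bsub>S\<^esub> h y) = (i \<otimes>\<^bsub>S\<^esub> w) \<otimes>\<^bsub>S\<^esub> (j \<otimes>\<^bsub>S\<^esub> h y)"
      using IH(1)[OF prod(1)] jc w hy by (simp add: S.m_ac)
    also have "\<dots> = h (p \<otimes> q)"
      using p q ideal.Icarr[OF P] ideal.Icarr[OF I] by simp
    finally show ?case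
      using IH(1)[OF prod(1)] jc ideal_prod.prod[OF p(1) q(1), of R] by (simp add: B_def)
  next
    case (sum s1 s2)
    then obtain p q where "p \<in> ideal_prod R P I" "s1 \<otimes>\<^bsub>S\<^esub> (w \<otimes>\<^bsub>S\<^esub> h y) = h p"
      "q \<in> ideal_prod R P I" "s2 \<otimes>\<^bsub>S\<^esub> (w \<otimes>\<^bsub>S\<^esub> h y) = h q"
      by blast
    moreover from this have "h (p \<oplus> q) = h p \<oplus>\<^bsub>S\<^esub> h q"
      using ideal.Icarr[OF PI] by simp
    ultimately have "(s1 \<oplus>\<^bsub>S\<^esub> s2) \<otimes>\<^bsub>S\<^esub> (w \<otimes>\<^bsub>S\<^esub> h y) = h (p \<oplus> q)"
      "p \<oplus> q \<in> ideal_prod R P I"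
      using sum w hy by (auto simp: S.l_distr intro: ideal_prod.sum)
    then show ?case using sum by (simp add: B_def)
  qed
  then show ?case by (simp add: P_def w_def)
qed

lemma colon_integrally_closed:
  fixes I J defines "B \<equiv> S\<lparr>carrier := colon S (h ` J) (h ` J)\<rparr>"
  assumes I: "integrally_closed_ideal I R" and J: "ideal J R" and IJ: "I \<subseteq> J"
  shows "integrally_closed_ideal (colon S (h ` I) (h ` J)) B"
proof -
  let ?K = "colon S (h ` I) (h ` J)"
  have idl: "ideal I R" using I by (simp add: integrally_closed_ideal_def)
  have Jc: "J \<subseteq> carrier R" using ideal.Icarr[OF J] by blast
  have T: "subcring (colon S (h ` J) (h ` J)) S"
    using image_subgroup[OF J] by (rule S.colon_self_subcring)
  interpret B: cring B
    unfolding B_def using T S.subcring_iff[OF subcringE(1)[OF T]] by simp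
  have K: "ideal ?K B"
    unfolding B_def using image_subgroup[OF idl] image_subgroup[OF J] image_mono[OF IJ]
    by (rule S.colon_ideal)
  have "x \<in> ?K" if "x \<in> ideal_integral_closure B ?K" for x
  proof -
    from that obtain n :: nat and a where x: "x \<in> carrier B" and n: "1 \<le> n"
      and a: "\<forall>i \<in> {1..n}. a i \<in> ?K [^]\<^bsub>ideals_set B\<^esub> i"
      and eq: "x [^]\<^bsub>B\<^esub> n \<oplus>\<^bsub>B\<^esub> (\<Oplus>\<^bsub>B\<^esub>i \<in> {1..n}. a i \<otimes>\<^bsub>B\<^esub> x [^]\<^bsub>B\<^esub> (n - i)) = \<zero>\<^bsub>B\<^esub>"
      unfolding ideal_integral_closure_def by blast
    have xc: "x \<in> colon S (h ` J) (h ` J)" using x by (simp add: B_def)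
    \<comment> \<open>Powers involve only the multiplication and unit that \<open>B\<close> shares
      with \<open>S\<close>. The finite sum depends on the carrier, so its terms have to be checked
      to lie in \<open>B\<close> before the equation moves to \<open>S\<close>.\<close>
    have pow: "x [^]\<^bsub>B\<^esub> m = x [^]\<^bsub>S\<^esub> m" for m :: nat
      by (simp add: B_def nat_pow_def)
    have aB: "a i \<in> carrier B" if "i \<in> {1..n}" for i
      using ideal.Icarr[OF B.ideals_set_pow_ideal[OF K] bspec[OF a that]] .
    have "(\<lambda>i. a i \<otimes>\<^bsub>S\<^esub> x [^]\<^bsub>S\<^esub> (n - i)) \<in> {1..n} \<rightarrow> colon S (h ` J) (h ` J)"
    proof
      fix i assume "i \<in> {1..n}"
      then have "a i \<otimes>\<^bsub>B\<^esub> x [^]\<^bsub>B\<^esub> (n - i) \<in> carrier B" using aB x by simp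
      then show "a i \<otimes>\<^bsub>S\<^esub> x [^]\<^bsub>S\<^esub> (n - i) \<in> colon S (h ` J) (h ` J)"
        unfolding pow by (simp add: B_def)
    qed
    from S.subcring_finsum[OF T this]
    have eqS: "x [^]\<^bsub>S\<^esub> n \<oplus>\<^bsub>S\<^esub> (\<Oplus>\<^bsub>S\<^esub>i \<in> {1..n}. a i \<otimes>\<^bsub>S\<^esub> x [^]\<^bsub>S\<^esub> (n - i)) = \<zero>\<^bsub>S\<^esub>"
      using eq unfolding pow by (simp add: B_def)
    have "x \<otimes>\<^bsub>S\<^esub> h y \<in> h ` I" if y: "y \<in> J" for y
    proof -
      \<comment> \<open>Membership of \<open>x\<close> in J : J already brings the product into the
        image of \<open>J\<close>; the integral equation then sharpens \<open>J\<close> to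
        \<open>I\<close>.\<close>
      obtain u where u: "u \<in> J" "x \<otimes>\<^bsub>S\<^esub> h y = h u" using colonD[OF xc] y by blast
      have ay: "a i \<in> carrier S \<and> a i \<otimes>\<^bsub>S\<^esub> h y [^]\<^bsub>S\<^esub> i \<in> h ` (I [^]\<^bsub>ideals_set R\<^esub> i)"
        if i: "i \<in> {1..n}" for i
      proof -
        obtain k where k: "i = Suc k" using i by (cases i) auto
        show ?thesis
          using colon_pow_mult_mem[OF B.is_cring[unfolded B_def] K[unfolded B_def] idl Jc y]
            bspec[OF a i] unfolding k B_def by blast
      qed
      have "u \<in> I"
        using integral_equation_imp_mem[OF I colon_carrier[OF xc] _ _ u(2) n _ _ eqS]
          ay y u(1) Jc by blast
      then show ?thesis using u(2) by simp
    qed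
    then show ?thesis using colon_carrier[OF xc] by (auto simp: colon_def)
  qed
  then show ?thesis
    unfolding integrally_closed_ideal_def
    using K B.ideal_subset_integral_closure[OF K] by blast
qed

section \<open>The action of J : J on \<open>I\<close>, and division by \<open>b\<close>\<close>

lemma colon_self_mult_mem:
  assumes noeth: "noetherian_ring R"
    and I: "integrally_closed_ideal I R" and J: "ideal J R" and IJ: "I \<subseteq> J"
    and s: "s \<in> J" "h s \<in> nonzerodivisors S"
    and c: "c \<in> colon S (h ` J) (h ` J)" and x: "x \<in> I"
  shows "c \<otimes>\<^bsub>S\<^esub> h x \<in> h ` I"
proof -
  interpret N: noetherian_ring R by fact
  have Jc: "J \<subseteq> carrier R" using ideal.Icarr[OF J] by blast
  have idl: "ideal I R" using I by (simp add: integrally_closed_ideal_def)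
  have cS: "c \<in> carrier S" using c by (rule colon_carrier)
  have hs: "h s \<in> carrier S" using s Jc by blast
  have "c [^]\<^bsub>S\<^esub> k \<otimes>\<^bsub>S\<^esub> h s \<in> h ` J" for k :: nat
  proof (induction k)
    case 0
    then show ?case using s hs by simp
  next
    case (Suc k)
    have "c [^]\<^bsub>S\<^esub> Suc k \<otimes>\<^bsub>S\<^esub> h s = c \<otimes>\<^bsub>S\<^esub> (c [^]\<^bsub>S\<^esub> k \<otimes>\<^bsub>S\<^esub> h s)"
      using cS hs by (simp add: S.m_ac)
    then show ?case using colonD[OF c Suc.IH] by simp
  qed
  \<comment> \<open>The products with \<open>h s\<close> are pulled back to \<open>R\<close>, since
    the chain condition is available in \<open>R\<close> and not in \<open>S\<close>.\<close>
  then have "\<forall>k. \<exists>t. t \<in> J \<and> h t = c [^]\<^bsub>S\<^esub> (k::nat) \<otimes>\<^bsub>S\<^esub> h s" by (metis imageE)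
  then obtain t where tJ: "\<And>k. t k \<in> J"
    and ht: "\<And>k. h (t k) = c [^]\<^bsub>S\<^esub> (k::nat) \<otimes>\<^bsub>S\<^esub> h s"
    by metis
  have tc: "t k \<in> carrier R" for k using tJ Jc by blast
  obtain n r where n: "1 \<le> n" and r: "\<And>i. r i \<in> carrier R"
    and tn: "t n = (\<Oplus>i \<in> {..<n}. r i \<otimes> t i)"
    by (rule N.sequence_linear_dependence[OF R.is_cring, of t, OF tc]) (rule that)
  \<comment> \<open>The relation lists powers of \<open>c\<close> by exponent
    \<open>0, ..., n - 1\<close>, whereas an integral equation lists coefficients by
    \<open>i = 1, ..., n\<close> at the power \<open>n - i\<close>. Hence the reversed index
    \<open>n - i\<close>.\<close>
  define f where "f i = h (r (n - i)) \<otimes>\<^bsub>S\<^esub> c [^]\<^bsub>S\<^esub> (n - i)" for i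
  have f: "f i \<in> carrier S" for i using r cS by (simp add: f_def)
  have "c [^]\<^bsub>S\<^esub> n \<otimes>\<^bsub>S\<^esub> h s = (\<Oplus>\<^bsub>S\<^esub>i \<in> {..<n}. (h \<circ> (\<lambda>i. r i \<otimes> t i)) i)"
    unfolding ht[symmetric] tn using r tc by (intro hom_finsum) auto
  also have "\<dots> = (\<Oplus>\<^bsub>S\<^esub>i \<in> {..<n}. h (r i) \<otimes>\<^bsub>S\<^esub> c [^]\<^bsub>S\<^esub> i \<otimes>\<^bsub>S\<^esub> h s)"
    using r tc cS hs by (intro S.finsum_cong') (auto simp: ht S.m_assoc)
  also have "\<dots> = (\<Oplus>\<^bsub>S\<^esub>i \<in> {..<n}. h (r i) \<otimes>\<^bsub>S\<^esub> c [^]\<^bsub>S\<^esub> i) \<otimes>\<^bsub>S\<^esub> h s"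
    using r cS hs by (intro S.finsum_ldistr[symmetric]) auto
  finally have "h s \<otimes>\<^bsub>S\<^esub> c [^]\<^bsub>S\<^esub> n = h s \<otimes>\<^bsub>S\<^esub> (\<Oplus>\<^bsub>S\<^esub>i \<in> {..<n}. h (r i) \<otimes>\<^bsub>S\<^esub> c [^]\<^bsub>S\<^esub> i)"
    using r cS hs by (simp add: S.m_comm S.finsum_closed Pi_def)
  moreover have "(\<Oplus>\<^bsub>S\<^esub>i \<in> {..<n}. h (r i) \<otimes>\<^bsub>S\<^esub> c [^]\<^bsub>S\<^esub> i) \<in> carrier S"
    using r cS by (intro S.finsum_closed) auto
  ultimately have "c [^]\<^bsub>S\<^esub> n = (\<Oplus>\<^bsub>S\<^esub>i \<in> {..<n}. h (r i) \<otimes>\<^bsub>S\<^esub> c [^]\<^bsub>S\<^esub> i)"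
    using cS by (metis S.nonzerodivisor_cancel[OF s(2)] S.nat_pow_closed)
  also have "{..<n} = (\<lambda>i. n - i) ` {1..n}"
  proof
    show "{..<n} \<subseteq> (\<lambda>i. n - i) ` {1..n}"
    proof
      fix i assume "i \<in> {..<n}"
      then have "i = n - (n - i)" "n - i \<in> {1..n}" by auto
      then show "i \<in> (\<lambda>i. n - i) ` {1..n}" by (rule image_eqI)
    qed
  qed auto
  also have "(\<Oplus>\<^bsub>S\<^esub>i \<in> (\<lambda>i. n - i) ` {1..n}. h (r i) \<otimes>\<^bsub>S\<^esub> c [^]\<^bsub>S\<^esub> i) = (\<Oplus>\<^bsub>S\<^esub>i \<in> {1..n}. f i)"
    unfolding f_def using r cS by (intro S.finsum_reindex) (auto simp: inj_on_def)
  finally have cn: "c [^]\<^bsub>S\<^esub> n = (\<Oplus>\<^bsub>S\<^esub>i \<in> {1..n}. f i)" .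
  have "(\<Oplus>\<^bsub>S\<^esub>i \<in> {1..n}. \<ominus>\<^bsub>S\<^esub> h (r (n - i)) \<otimes>\<^bsub>S\<^esub> c [^]\<^bsub>S\<^esub> (n - i)) = (\<Oplus>\<^bsub>S\<^esub>i \<in> {1..n}. \<ominus>\<^bsub>S\<^esub> f i)"
    using r cS by (intro S.finsum_cong') (auto simp: f_def S.l_minus)
  then have "c [^]\<^bsub>S\<^esub> n \<oplus>\<^bsub>S\<^esub> (\<Oplus>\<^bsub>S\<^esub>i \<in> {1..n}. \<ominus>\<^bsub>S\<^esub> h (r (n - i)) \<otimes>\<^bsub>S\<^esub> c [^]\<^bsub>S\<^esub> (n - i)) =
      (\<Oplus>\<^bsub>S\<^esub>i \<in> {1..n}. f i \<oplus>\<^bsub>S\<^esub> \<ominus>\<^bsub>S\<^esub> f i)"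
    unfolding cn using f by (simp add: S.finsum_addf Pi_def)
  also have "\<dots> = \<zero>\<^bsub>S\<^esub>" using f by (simp add: S.r_neg)
  finally have eq: "c [^]\<^bsub>S\<^esub> n \<oplus>\<^bsub>S\<^esub>
      (\<Oplus>\<^bsub>S\<^esub>i \<in> {1..n}. \<ominus>\<^bsub>S\<^esub> h (r (n - i)) \<otimes>\<^bsub>S\<^esub> c [^]\<^bsub>S\<^esub> (n - i)) = \<zero>\<^bsub>S\<^esub>" .
  have xc: "x \<in> carrier R" using ideal.Icarr[OF idl x] .
  obtain u where u: "u \<in> J" "c \<otimes>\<^bsub>S\<^esub> h x = h u" using colonD[OF c] x IJ by blast
  \<comment> \<open>The coefficients come from \<open>R\<close> only; it is the factor
    \<open>x [^] i\<close> with \<open>x \<in> I\<close> that brings the scaled coefficients into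
    the powers of \<open>I\<close>.\<close>
  have "\<ominus>\<^bsub>S\<^esub> h (r (n - i)) \<otimes>\<^bsub>S\<^esub> h x [^]\<^bsub>S\<^esub> i \<in> h ` (I [^]\<^bsub>ideals_set R\<^esub> i)" for i
  proof (rule image_eqI)
    show "\<ominus>\<^bsub>S\<^esub> h (r (n - i)) \<otimes>\<^bsub>S\<^esub> h x [^]\<^bsub>S\<^esub> i = h (\<ominus> r (n - i) \<otimes> x [^] i)"
      using r xc by simp
    show "\<ominus> r (n - i) \<otimes> x [^] i \<in> I [^]\<^bsub>ideals_set R\<^esub> i"
      using R.pow_mem_ideals_set_pow[OF idl x] r
      by (intro ideal.I_l_closed[OF R.ideals_set_pow_ideal[OF idl]]) auto
  qed
  then have "u \<in> I"
    using r u(1) Jc by (intro integral_equation_imp_mem[OF I cS xc _ u(2) n _ _ eq]) auto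
  then show ?thesis using u(2) by simp
qed

text \<open>From left to right, an element of the colon is multiplied by \<open>h b\<close> and
  divided again. The reverse inclusion rests on \<open>colon_self_mult_mem\<close>, through which
  the Noetherian hypothesis and the integral closedness of \<open>I\<close> enter.\<close>

lemma colon_eq_divide:
  assumes noeth: "noetherian_ring R"
    and I: "integrally_closed_ideal I R" and J: "ideal J R" and IJ: "I \<subseteq> J"
    and b: "b \<in> J" and unit: "h b \<in> Units S" and nzd: "h b \<in> nonzerodivisors S"
    and JJ: "ideal_prod R J J = (\<lambda>x. b \<otimes> x) ` J"
  shows "colon S (h ` I) (h ` J) = (\<lambda>x. h x \<otimes>\<^bsub>S\<^esub> inv\<^bsub>S\<^esub> h b) ` I"
proof
  have Jc: "y \<in> carrier R" if "y \<in> J" for y using ideal.Icarr[OF J that] .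
  have inv: "inv\<^bsub>S\<^esub> h b \<in> carrier S" using unit by (rule S.Units_inv_closed)
  show "colon S (h ` I) (h ` J) \<subseteq> (\<lambda>x. h x \<otimes>\<^bsub>S\<^esub> inv\<^bsub>S\<^esub> h b) ` I"
  proof
    fix a assume a: "a \<in> colon S (h ` I) (h ` J)"
    obtain x where x: "x \<in> I" "a \<otimes>\<^bsub>S\<^esub> h b = h x" using colonD[OF a] b by blast
    have "a = a \<otimes>\<^bsub>S\<^esub> h b \<otimes>\<^bsub>S\<^esub> inv\<^bsub>S\<^esub> h b"
      using colon_carrier[OF a] unit inv by (simp add: S.m_assoc S.Units_closed)
    then show "a \<in> (\<lambda>x. h x \<otimes>\<^bsub>S\<^esub> inv\<^bsub>S\<^esub> h b) ` I" unfolding x(2) using x(1) by blast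
  qed
  show "(\<lambda>x. h x \<otimes>\<^bsub>S\<^esub> inv\<^bsub>S\<^esub> h b) ` I \<subseteq> colon S (h ` I) (h ` J)"
  proof clarify
    fix x assume x: "x \<in> I"
    have xc: "x \<in> carrier R" using x IJ Jc by blast
    have "h x \<otimes>\<^bsub>S\<^esub> inv\<^bsub>S\<^esub> h b \<otimes>\<^bsub>S\<^esub> h y \<in> h ` I" if y: "y \<in> J" for y
    proof -
      have "h y \<otimes>\<^bsub>S\<^esub> inv\<^bsub>S\<^esub> h b \<otimes>\<^bsub>S\<^esub> h z \<in> h ` J" if z: "z \<in> J" for z
      proof -
        have "y \<otimes> z \<in> ideal_prod R J J" using y z by (rule ideal_prod.prod)
        \<comment> \<open>\<open>JJ\<close> divides \<open>y \<otimes> z\<close> by \<open>b\<close>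
          with quotient in \<open>J\<close>, so y / b maps \<open>J\<close> into itself.\<close>
        then obtain j where j: "j \<in> J" "y \<otimes> z = b \<otimes> j" using JJ by blast
        have "h y \<otimes>\<^bsub>S\<^esub> inv\<^bsub>S\<^esub> h b \<otimes>\<^bsub>S\<^esub> h z = inv\<^bsub>S\<^esub> h b \<otimes>\<^bsub>S\<^esub> h (y \<otimes> z)"
          using Jc[OF y] Jc[OF z] inv by (simp add: S.m_ac)
        also have "\<dots> = h j"
          unfolding j(2) using Jc[OF b] Jc[OF j(1)] inv unit
          by (simp add: S.m_assoc[symmetric])
        finally show ?thesis using j(1) by blast
      qed
      then have "h y \<otimes>\<^bsub>S\<^esub> inv\<^bsub>S\<^esub> h b \<in> colon S (h ` J) (h ` J)"
        using Jc[OF y] inv by (auto simp: colon_def)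
      \<comment> \<open>The denominator is moved from \<open>x\<close> to \<open>y\<close>: the
        product is the element y / b of J : J acting on \<open>x \<in> I\<close>.\<close>
      from colon_self_mult_mem[OF noeth I J IJ b nzd this x]
      show ?thesis using Jc[OF y] xc inv by (simp add: S.m_ac)
    qed
    then show "h x \<otimes>\<^bsub>S\<^esub> inv\<^bsub>S\<^esub> h b \<in> colon S (h ` I) (h ` J)"
      using xc inv by (auto simp: colon_def)
  qed
qed

text \<open>Multiplying back by \<open>h b\<close> cancels the denominator. This form yields both
  the product formula and the module isomorphism.\<close>

lemma image_eq_mult_colon:
  assumes I: "I \<subseteq> carrier R" and unit: "h b \<in> Units S"
    and eq: "colon S (h ` I) X = (\<lambda>x. h x \<otimes>\<^bsub>S\<^esub> inv\<^bsub>S\<^esub> h b) ` I"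
  shows "h ` I = (\<lambda>z. h b \<otimes>\<^bsub>S\<^esub> z) ` colon S (h ` I) X"
proof -
  have "h b \<otimes>\<^bsub>S\<^esub> (h x \<otimes>\<^bsub>S\<^esub> inv\<^bsub>S\<^esub> h b) = h x" if "x \<in> I" for x
  proof -
    have "h b \<otimes>\<^bsub>S\<^esub> (h x \<otimes>\<^bsub>S\<^esub> inv\<^bsub>S\<^esub> h b) = h x \<otimes>\<^bsub>S\<^esub> (h b \<otimes>\<^bsub>S\<^esub> inv\<^bsub>S\<^esub> h b)"
      using that I unit by (intro S.m_lcomm) auto
    then show ?thesis using that I unit by auto
  qed
  then show ?thesis unfolding eq image_image by (intro image_cong[symmetric]) simp_all
qed

text \<open>Since \<open>b \<in> J\<close>, every element of the image of \<open>I\<close> is a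
  single product; conversely, the colon sends the image of \<open>J\<close> into that of
  \<open>I\<close>, which is closed under sums. The factors of \<open>ideal_prod\<close> need not be
  ideals of \<open>S\<close>: it forms finite sums of products.\<close>

lemma image_eq_ideal_prod_colon:
  assumes I: "ideal I R" and J: "J \<subseteq> carrier R" and b: "b \<in> J"
    and eq: "h ` I = (\<lambda>z. h b \<otimes>\<^bsub>S\<^esub> z) ` colon S (h ` I) (h ` J)"
  shows "h ` I = ideal_prod S (h ` J) (colon S (h ` I) (h ` J))"
proof
  show "h ` I \<subseteq> ideal_prod S (h ` J) (colon S (h ` I) (h ` J))"
    by (subst eq) (use b in \<open>auto intro: ideal_prod.prod\<close>)
  show "ideal_prod S (h ` J) (colon S (h ` I) (h ` J)) \<subseteq> h ` I"
  proof
    fix x assume "x \<in> ideal_prod S (h ` J) (colon S (h ` I) (h ` J))"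
    then show "x \<in> h ` I"
    proof (induction x rule: ideal_prod.induct)
      case (prod y a)
      moreover have "y \<otimes>\<^bsub>S\<^esub> a = a \<otimes>\<^bsub>S\<^esub> y"
        using prod J colon_carrier[OF prod(2)] by (intro S.m_comm) auto
      ultimately show ?case using colonD by fastforce
    next
      case (sum s1 s2)
      then show ?case using subgroup.m_closed[OF image_subgroup[OF I]] by simp
    qed
  qed
qed

end


section \<open>The total ring of fractions\<close>

lemma (in cring) Units_nonzerodivisors:
  assumes "u \<in> Units R"
  shows "u \<in> nonzerodivisors R"
proof -
  have "x = \<zero>" if "x \<in> carrier R" "u \<otimes> x = \<zero>" for x
    using assms that by (metis Units_closed Units_l_cancel r_null zero_closed)
  then show ?thesis using assms by (auto simp: nonzerodivisors_def)
qed

text \<open>The inverse is \<open>fraction R \<one> s\<close>.\<close>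

lemma (in cring) fraction_embed_Units:
  assumes s: "s \<in> nonzerodivisors R"
  shows "fraction_embed R s \<in> Units (total_fraction_ring R)"
proof -
  interpret Q: cring "total_fraction_ring R" by (rule total_fraction_ring_cring)
  have "fraction R \<one> s \<in> carrier (total_fraction_ring R)"
    using s unfolding total_fraction_ring_def by auto
  moreover have "fraction_embed R s \<in> carrier (total_fraction_ring R)"
    using ring_hom_closed[OF fraction_embed_hom] nonzerodivisors_carrier[OF s] .
  moreover have "fraction R \<one> s \<otimes>\<^bsub>total_fraction_ring R\<^esub> fraction_embed R s =
      \<one>\<^bsub>total_fraction_ring R\<^esub>"
    using fraction_mult_denominator[OF one_closed s] ring_hom_one[OF fraction_embed_hom] by simp
  ultimately show ?thesis unfolding Units_def using Q.m_comm by fastforce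
qed

text \<open>Multiply by the denominator and cancel the resulting unit. This links fractions as
  classes of pairs with the quotients by units used in \<open>ring_extension\<close>.\<close>

lemma (in cring) fraction_eq_divide:
  assumes a: "a \<in> carrier R" and s: "s \<in> nonzerodivisors R"
  shows "fraction R a s = fraction_embed R a \<otimes>\<^bsub>total_fraction_ring R\<^esub>
    inv\<^bsub>total_fraction_ring R\<^esub> fraction_embed R s"
proof -
  interpret Q: cring "total_fraction_ring R" by (rule total_fraction_ring_cring)
  have "fraction R a s \<in> carrier (total_fraction_ring R)"
    using a s unfolding total_fraction_ring_def by auto
  then show ?thesis
    using fraction_embed_Units[OF s] unfolding fraction_mult_denominator[OF a s, symmetric]
    by (simp add: Q.m_assoc Q.Units_closed)
qed

text \<open>For a non-zerodivisor \<open>s \<in> J\<close>, the square of \<open>s\<close> is a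
  multiple of \<open>b\<close>; so anything killed by \<open>b\<close> is killed by this square,
  which is again a non-zerodivisor.\<close>

lemma (in cring) principal_reduction_nonzerodivisor:
  assumes J: "ideal J R" "J \<inter> nonzerodivisors R \<noteq> {}" and b: "b \<in> J"
    and JJ: "ideal_prod R J J = (\<lambda>x. b \<otimes> x) ` J"
  shows "b \<in> nonzerodivisors R"
proof -
  obtain s where s: "s \<in> J" "s \<in> nonzerodivisors R" using J(2) by blast
  have "s \<otimes> s \<in> ideal_prod R J J" using s(1) s(1) by (rule ideal_prod.prod)
  then obtain j where j: "j \<in> J" "s \<otimes> s = b \<otimes> j" using JJ by blast
  have Jc: "x \<in> carrier R" if "x \<in> J" for x using ideal.Icarr[OF J(1) that] .
  have "x = \<zero>" if x: "x \<in> carrier R" "b \<otimes> x = \<zero>" for x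
  proof -
    have "s \<otimes> s \<otimes> x = j \<otimes> (b \<otimes> x)"
      unfolding j(2) using x(1) Jc[OF b] Jc[OF j(1)] by (simp add: m_ac)
    then show ?thesis
      using x Jc[OF j(1)] mult_nonzerodivisor[OF s(2) s(2)] by (simp add: nonzerodivisors_def)
  qed
  then show ?thesis using Jc[OF b] by (simp add: nonzerodivisors_def)
qed

theorem theorem3p3:
  fixes R :: "('a, 'm) ring_scheme"
    and I J :: "'a set"
    and Q :: "('a \<times> 'a) set ring"
    and IQ JQ :: "('a \<times> 'a) set set"
    and B :: "('a \<times> 'a) set ring"
  assumes "cring R" and "noetherian_ring R"
    and "I \<in> \<X>\<^bsub>R\<^esub>" and "J \<in> \<X>\<^bsub>R\<^esub>" and "I \<subseteq> J"
    and "Q = total_fraction_ring R"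
    and "IQ = fraction_embed R ` I" and "JQ = fraction_embed R ` J"
    and "B = Q\<lparr>carrier := colon Q JQ JQ\<rparr>"
  shows "colon Q IQ JQ \<in> \<X>\<^bsub>B\<^esub> \<and>
         (\<forall>b \<in> J. ideal_prod R J J = (\<lambda>x. b \<otimes>\<^bsub>R\<^esub> x) ` J \<longrightarrow>
           colon Q IQ JQ = (\<lambda>x. fraction R x b) ` I \<and>
           IQ = ideal_prod Q JQ (colon Q IQ JQ) \<and>
           module_isomorphic B (submodule_of_ring Q (colon Q IQ JQ)) (submodule_of_ring Q IQ))"
proof (intro conjI ballI impI)
  interpret R: cring R by fact
  interpret Q: cring Q unfolding assms(6) by (rule R.total_fraction_ring_cring)
  interpret ring_extension R Q "fraction_embed R"
    using R.fraction_embed_hom R.fraction_embed_inj unfolding assms(6)[symmetric]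
    by unfold_locales
  have I: "integrally_closed_ideal I R" "ideal I R"
    and J: "ideal J R" "J \<inter> nonzerodivisors R \<noteq> {}"
    using assms(3,4)
    by (auto simp: regular_integrally_closed_ideals_def integrally_closed_ideal_def)
  have Ic: "I \<subseteq> carrier R" using ideal.Icarr[OF I(2)] by blast
  have Jc: "J \<subseteq> carrier R" using ideal.Icarr[OF J(1)] by blast
  have IQ: "subgroup IQ (add_monoid Q)" unfolding assms(7) by (rule image_subgroup[OF I(2)])
  have JQ: "subgroup JQ (add_monoid Q)" unfolding assms(8) by (rule image_subgroup[OF J(1)])
  have JQc: "JQ \<subseteq> carrier Q" unfolding assms(8) using Jc by blast
  have K: "integrally_closed_ideal (colon Q IQ JQ) B"
    unfolding assms(7-9) by (rule colon_integrally_closed[OF I(1) J(1) assms(5)])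
  show "colon Q IQ JQ \<in> \<X>\<^bsub>B\<^esub>"
  proof -
    \<comment> \<open>A non-zerodivisor of \<open>I\<close> serves as witness: its products with
      \<open>J\<close> stay in the ideal \<open>I\<close>, so its image lies in the colon.\<close>
    obtain s where s: "s \<in> I" "s \<in> nonzerodivisors R"
      using assms(3) by (auto simp: regular_integrally_closed_ideals_def)
    have sc: "s \<in> carrier R" using s(1) Ic by blast
    have "fraction_embed R s \<otimes>\<^bsub>Q\<^esub> fraction_embed R y \<in> IQ" if y: "y \<in> J" for y
    proof -
      have "fraction_embed R s \<otimes>\<^bsub>Q\<^esub> fraction_embed R y = fraction_embed R (s \<otimes>\<^bsub>R\<^esub> y)"
        using sc y Jc by auto
      then show ?thesis
        using ideal.I_r_closed[OF I(2) s(1)] y Jc unfolding assms(7) by auto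
    qed
    then have sK: "fraction_embed R s \<in> colon Q IQ JQ"
      using sc unfolding assms(8) by (auto simp: colon_def)
    \<comment> \<open>Being a unit of \<open>Q\<close>, the image of \<open>s\<close> is a
      non-zerodivisor of \<open>Q\<close>, and this passes to the subring \<open>B\<close>.\<close>
    have "fraction_embed R s \<in> nonzerodivisors Q"
      using R.fraction_embed_Units[OF s(2)] unfolding assms(6)[symmetric]
      by (rule Q.Units_nonzerodivisors)
    moreover have "fraction_embed R s \<in> carrier B"
      using K sK ideal.Icarr unfolding integrally_closed_ideal_def by metis
    ultimately have "fraction_embed R s \<in> nonzerodivisors B"
      unfolding assms(9) by (auto simp: nonzerodivisors_def colon_def)
    then show ?thesis using K sK by (auto simp: regular_integrally_closed_ideals_def)
  qed
  fix b assume b: "b \<in> J" and JJ: "ideal_prod R J J = (\<lambda>x. b \<otimes>\<^bsub>R\<^esub> x) ` J"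
  have bn: "b \<in> nonzerodivisors R"
    using J b JJ by (rule R.principal_reduction_nonzerodivisor)
  have unit: "fraction_embed R b \<in> Units Q"
    using R.fraction_embed_Units[OF bn] unfolding assms(6) .
  have nzd: "fraction_embed R b \<in> nonzerodivisors Q"
    using unit by (rule Q.Units_nonzerodivisors)
  have divide: "colon Q IQ JQ = (\<lambda>x. fraction_embed R x \<otimes>\<^bsub>Q\<^esub> inv\<^bsub>Q\<^esub> fraction_embed R b) ` I"
    unfolding assms(7,8) by (rule colon_eq_divide[OF assms(2) I(1) J(1) assms(5) b unit nzd JJ])
  also have "\<dots> = (\<lambda>x. fraction R x b) ` I"
    using Ic bn unfolding assms(6) by (intro image_cong refl R.fraction_eq_divide[symmetric]) auto
  finally show "colon Q IQ JQ = (\<lambda>x. fraction R x b) ` I" .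
  \<comment> \<open>Multiplication by \<open>b\<close> carries I : J onto \<open>I\<close>; this
    gives the product formula and is also the map behind the isomorphism.\<close>
  have mult: "IQ = (\<lambda>z. fraction_embed R b \<otimes>\<^bsub>Q\<^esub> z) ` colon Q IQ JQ"
    using image_eq_mult_colon[OF Ic unit divide[unfolded assms(7)]] unfolding assms(7) .
  then show "IQ = ideal_prod Q JQ (colon Q IQ JQ)"
    unfolding assms(7,8) by (rule image_eq_ideal_prod_colon[OF I(2) Jc b])
  \<comment> \<open>Stability of I : J under \<open>B\<close> is \<open>colon_mult\<close> up to
    commutation, and makes the colon a module over \<open>B\<close>.\<close>
  have "a \<otimes>\<^bsub>Q\<^esub> x \<in> colon Q IQ JQ" if a: "a \<in> colon Q JQ JQ" and x: "x \<in> colon Q IQ JQ" for a x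
    using Q.colon_mult[OF x a JQc] Q.m_comm colon_carrier[OF a] colon_carrier[OF x] by simp
  then show "module_isomorphic B (submodule_of_ring Q (colon Q IQ JQ)) (submodule_of_ring Q IQ)"
    unfolding assms(9)
    by (intro Q.submodule_of_ring_isomorphic[OF Q.colon_self_subcring[OF JQ]
          Q.colon_subgroup[OF IQ JQc] _ IQ mult nzd])
qed

end
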